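(* Let $\alpha\in[0,\infty]$ and let $Y$ be a convergence-approach space. If $S$ is an $\alpha$-$\oplus$-strict subspace of a convergence-approach space $X$ and $f:S\to Y$ is a contraction, then every $\oplus$-regular extension $g:h(S,f,\alpha)\to Y$ of $f$ satisfies $m_{\oplus}(g)\leq\alpha\oplus\alpha$.
   Context: Filters are proper. $\mathbb{F}X$ is the set of filters on $X$, ordered by inclusion ($\mathcal{F}\le\mathcal{G}$ iff $\mathcal{F}\subseteq\mathcal{G}$); $\mathbb{U}X$ is the set of ultrafilters; $\mathcal{F}\wedge\mathcal{G}=\mathcal{F}\cap\mathcal{G}$; $\mathcal{A}^{\uparrow}=\{B\subseteq X:\exists A\in\mathcal{A},\ A\subseteq B\}$; $\{x\}^{\uparrow}$ is the principal ultrafilter at $x$. A filter base is identified with the filter it generates, and a filter on a subset of $X$ is identified with the filter it generates on $X$ where needed. $f[\mathcal{F}]=\{f(F):F\in\mathcal{F}\}^{\uparrow}$. A convergence-approach space (CAP space) is a pair $(X,\lambda_X)$ with $\lambda_X:\mathbb{F}X\to[0,\infty]^{X}$ (ordered pointwise) such that $\lambda_X(\mathcal{F}\wedge\mathcal{G})=\lambda_X(\mathcal{F})\vee\lambda_X(\mathcal{G})$ for all $\mathcal{F},\mathcal{G}\in\mathbb{F}X$ and $\lambda_X(\{x\}^{\uparrow})(x)=0$ for all $x\in X$. A subset $S\subseteq X$ carries the subspace (initial) structure $\lambda_S(\mathcal{F})(x)=\lambda_X(\mathcal{F}^{\uparrow})(x)$. A map $f:X\to Y$ between CAP spaces is a contraction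 if $\lambda_Y(f[\mathcal{F}])\circ f\le\lambda_X(\mathcal{F})$ for every $\mathcal{F}\in\mathbb{F}X$. $\oplus:[0,\infty]\times[0,\infty]\to[0,\infty]$ is a fixed commutative associative operation such that $0\oplus r=r$ and $r\oplus\bigwedge_{a\in A}a=\bigwedge_{a\in A}(r\oplus a)$ for all $r\in[0,\infty]$, $A\subseteq[0,\infty]$ (where $\bigwedge$ is infimum). For a map $g:Z\to Y$ between CAP spaces, $$m_{\oplus}(g)=\inf\{\beta\in[0,\infty]:\forall\mathcal{G}\in\mathbb{F}Z,\ \lambda_{Y}(g[\mathcal{G}])\circ g\le\lambda_{Z}(\mathcal{G})\oplus\beta\}.$$ For $A\subseteq X$ and $\epsilon\in[0,\infty]$, $A^{(\epsilon)}=\{x\in X:\exists\,\mathcal{U}\in\mathbb{U}X,\ A\in\mathcal{U},\ \lambda_X(\mathcal{U})(x)\le\epsilon\}$, and $\mathcal{F}^{(\epsilon)}=\{F^{(\epsilon)}:F\in\mathcal{F}\}$. A point $y$ of a CAP space $Y$ is a $\oplus$-regularity point if $\lambda_Y(\mathcal{F}^{(\epsilon)})(y)\le\lambda_Y(\mathcal{F})(y)\oplus\epsilon$ for all $\mathcal{F}\in\mathbb{F}Y$, $\epsilon\in[0,\infty]$. A subset $S\subseteq X$ is an $\alpha$-$\oplus$-strict subspace if for every $x\in S^{(\alpha)}$ and every $\mathcal{F}\in\mathbb{F}(S^{(\alpha)})$ there is $\mathcal{G}\in\mathbb{F}S$ with $\mathcal{G}^{(\alpha)}\le\mathcal{F}$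 and $\lambda_X(\mathcal{G})(x)\le\lambda_X(\mathcal{F})(x)\oplus\alpha$. For $S\subseteq X$, $f:S\to Y$, $x\in X$ and $\alpha,\epsilon\in[0,\infty]$: $H_S^{\epsilon}(x)=\{\mathcal{F}\in\mathbb{F}S:\lambda_X(\mathcal{F})(x)\le\epsilon\}$; $F_S^{\epsilon}(x)=\{y\in Y:\forall\mathcal{F}\in H_S^{\epsilon}(x),\ \lambda_Y(f[\mathcal{F}])(y)\le\epsilon\}$; $h(S,f,\alpha)=\{x\in S^{(\alpha)}:\bigcap_{\epsilon\in[0,\infty]}F_S^{\epsilon}(x)\ne\emptyset\}$, regarded as a subspace of $X$. For a contraction $f:S\to Y$, an admissible extension of $f$ is a function $g:h(S,f,\alpha)\to Y$ with $g_{|S}=f$ and $g(x)\in\bigcap_{\epsilon\in[0,\infty]}F_S^{\epsilon}(x)$ for each $x\in h(S,f,\alpha)$; it is a $\oplus$-regular extension if moreover each $g(x)$ is a $\oplus$-regularity point of $Y$. *)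

theory Defs
  imports "HOL-Library.Extended_Nonnegative_Real"
begin

text \<open>
  A proper filter on a set \<open>S \<subseteq> X\<close>, and the filter it generates on \<open>X\<close>, are both represented
  by the same library filter \<open>F \<noteq> bot\<close> with \<open>F \<le> principal S\<close>; a set \<open>A\<close> is a member of \<open>F\<close> iff
  \<open>\<forall>\<^sub>F x in F. x \<in> A\<close>. Hence the subspace structure on \<open>S\<close> is given by the limit function
  of \<open>X\<close> itself, and the image filter is \<^const>\<open>filtermap\<close>.

  The library order on filters is the reverse of inclusion: ``\<open>F\<close> is contained in \<open>G\<close>'' is
  \<open>G \<le> F\<close>, the intersection of \<open>F\<close> and \<open>G\<close> is \<open>sup F G\<close>, and \<open>principal {x}\<close> is the principal
  ultrafilter at \<open>x\<close>.
\<close>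

definition filters_on :: "'a set \<Rightarrow> 'a filter set" where
  "filters_on S = {F. F \<noteq> bot \<and> F \<le> principal S}"

definition ultrafilters_on :: "'a set \<Rightarrow> 'a filter set" where
  "ultrafilters_on S = {U \<in> filters_on S. \<forall>F \<in> filters_on S. F \<le> U \<longrightarrow> F = U}"

locale cap_space =
  fixes X :: "'a set" and lam :: "'a filter \<Rightarrow> 'a \<Rightarrow> ennreal"
  assumes lam_sup: "\<lbrakk>F \<in> filters_on X; G \<in> filters_on X; x \<in> X\<rbrakk>
      \<Longrightarrow> lam (sup F G) x = max (lam F x) (lam G x)"
    and lam_principal: "x \<in> X \<Longrightarrow> lam (principal {x}) x = 0"

definition contraction ::
  "'a set \<Rightarrow> ('a filter \<Rightarrow> 'a \<Rightarrow> ennreal) \<Rightarrow> 'b set \<Rightarrow> ('b filter \<Rightarrow> 'b \<Rightarrow> ennreal)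
    \<Rightarrow> ('a \<Rightarrow> 'b) \<Rightarrow> bool" where
  "contraction X lamX Y lamY f \<longleftrightarrow> f ` X \<subseteq> Y \<and>
    (\<forall>F \<in> filters_on X. \<forall>x \<in> X. lamY (filtermap f F) (f x) \<le> lamX F x)"

locale sum_operation =
  fixes oplus :: "ennreal \<Rightarrow> ennreal \<Rightarrow> ennreal"
  assumes oplus_commute: "oplus r s = oplus s r"
    and oplus_assoc: "oplus (oplus r s) t = oplus r (oplus s t)"
    and oplus_zero: "oplus 0 r = r"
    and oplus_Inf: "oplus r (Inf A) = (INF a \<in> A. oplus r a)"

definition measure_of_contraction ::
  "(ennreal \<Rightarrow> ennreal \<Rightarrow> ennreal) \<Rightarrow> 'a set \<Rightarrow> ('a filter \<Rightarrow> 'a \<Rightarrow> ennreal)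
    \<Rightarrow> 'b set \<Rightarrow> ('b filter \<Rightarrow> 'b \<Rightarrow> ennreal) \<Rightarrow> ('a \<Rightarrow> 'b) \<Rightarrow> ennreal" where
  "measure_of_contraction oplus Z lamZ Y lamY g =
    Inf {\<beta>. \<forall>G \<in> filters_on Z. \<forall>z \<in> Z. lamY (filtermap g G) (g z) \<le> oplus (lamZ G z) \<beta>}"

definition adh ::
  "'a set \<Rightarrow> ('a filter \<Rightarrow> 'a \<Rightarrow> ennreal) \<Rightarrow> ennreal \<Rightarrow> 'a set \<Rightarrow> 'a set" where
  "adh X lam \<epsilon> A = {x \<in> X. \<exists>U \<in> ultrafilters_on X. (\<forall>\<^sub>F y in U. y \<in> A) \<and> lam U x \<le> \<epsilon>}"

text \<open>The filter generated by the base of all \<open>adh X lam \<epsilon> A\<close> with \<open>A\<close> in \<open>F\<close>;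
  see \<open>eventually_adh_filter\<close> below.\<close>

definition adh_filter ::
  "'a set \<Rightarrow> ('a filter \<Rightarrow> 'a \<Rightarrow> ennreal) \<Rightarrow> ennreal \<Rightarrow> 'a filter \<Rightarrow> 'a filter" where
  "adh_filter X lam \<epsilon> F = (INF A \<in> {A. \<forall>\<^sub>F y in F. y \<in> A}. principal (adh X lam \<epsilon> A))"

lemma adh_mono: "A \<subseteq> B \<Longrightarrow> adh X lam \<epsilon> A \<subseteq> adh X lam \<epsilon> B"
  unfolding adh_def by (blast intro: eventually_mono)

lemma eventually_adh_filter:
  "eventually P (adh_filter X lam \<epsilon> F) \<longleftrightarrow>
    (\<exists>A. (\<forall>\<^sub>F y in F. y \<in> A) \<and> (\<forall>x \<in> adh X lam \<epsilon> A. P x))"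
proof -
  let ?B = "{A. \<forall>\<^sub>F y in F. y \<in> A}"
  have "eventually P (adh_filter X lam \<epsilon> F) \<longleftrightarrow>
      (\<exists>A \<in> ?B. eventually P (principal (adh X lam \<epsilon> A)))"
    unfolding adh_filter_def
  proof (rule eventually_INF_base)
    show "?B \<noteq> {}" by (auto intro!: exI[of _ UNIV])
  next
    fix A B assume "A \<in> ?B" "B \<in> ?B"
    then have "A \<inter> B \<in> ?B" by (simp add: eventually_conj)
    then show "\<exists>C \<in> ?B. principal (adh X lam \<epsilon> C)
        \<le> inf (principal (adh X lam \<epsilon> A)) (principal (adh X lam \<epsilon> B))"
      by (intro bexI[of _ "A \<inter> B"]) (simp_all add: adh_mono)
  qed
  then show ?thesis by (simp add: eventually_principal)
qed

definition regularity_point ::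
  "(ennreal \<Rightarrow> ennreal \<Rightarrow> ennreal) \<Rightarrow> 'b set \<Rightarrow> ('b filter \<Rightarrow> 'b \<Rightarrow> ennreal) \<Rightarrow> 'b \<Rightarrow> bool" where
  "regularity_point oplus Y lam y \<longleftrightarrow> y \<in> Y \<and>
    (\<forall>F \<in> filters_on Y. \<forall>\<epsilon>. lam (adh_filter Y lam \<epsilon> F) y \<le> oplus (lam F y) \<epsilon>)"

text \<open>All adherences in the following definition are taken in \<open>X\<close>.\<close>

definition strict_subspace ::
  "(ennreal \<Rightarrow> ennreal \<Rightarrow> ennreal) \<Rightarrow> ennreal \<Rightarrow> 'a set \<Rightarrow> ('a filter \<Rightarrow> 'a \<Rightarrow> ennreal)
    \<Rightarrow> 'a set \<Rightarrow> bool" where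
  "strict_subspace oplus \<alpha> X lam S \<longleftrightarrow> S \<subseteq> X \<and>
    (\<forall>x \<in> adh X lam \<alpha> S. \<forall>F \<in> filters_on (adh X lam \<alpha> S).
      \<exists>G \<in> filters_on S. F \<le> adh_filter X lam \<alpha> G \<and> lam G x \<le> oplus (lam F x) \<alpha>)"

definition H_set ::
  "('a filter \<Rightarrow> 'a \<Rightarrow> ennreal) \<Rightarrow> 'a set \<Rightarrow> ennreal \<Rightarrow> 'a \<Rightarrow> 'a filter set" where
  "H_set lamX S \<epsilon> x = {F \<in> filters_on S. lamX F x \<le> \<epsilon>}"

definition F_set ::
  "('a filter \<Rightarrow> 'a \<Rightarrow> ennreal) \<Rightarrow> 'b set \<Rightarrow> ('b filter \<Rightarrow> 'b \<Rightarrow> ennreal)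
    \<Rightarrow> 'a set \<Rightarrow> ('a \<Rightarrow> 'b) \<Rightarrow> ennreal \<Rightarrow> 'a \<Rightarrow> 'b set" where
  "F_set lamX Y lamY S f \<epsilon> x =
    {y \<in> Y. \<forall>F \<in> H_set lamX S \<epsilon> x. lamY (filtermap f F) y \<le> \<epsilon>}"

definition h_set ::
  "'a set \<Rightarrow> ('a filter \<Rightarrow> 'a \<Rightarrow> ennreal) \<Rightarrow> 'b set \<Rightarrow> ('b filter \<Rightarrow> 'b \<Rightarrow> ennreal)
    \<Rightarrow> 'a set \<Rightarrow> ('a \<Rightarrow> 'b) \<Rightarrow> ennreal \<Rightarrow> 'a set" where
  "h_set X lamX Y lamY S f \<alpha> =
    {x \<in> adh X lamX \<alpha> S. (\<Inter>\<epsilon>. F_set lamX Y lamY S f \<epsilon> x) \<noteq> {}}"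

definition admissible_extension ::
  "'a set \<Rightarrow> ('a filter \<Rightarrow> 'a \<Rightarrow> ennreal) \<Rightarrow> 'b set \<Rightarrow> ('b filter \<Rightarrow> 'b \<Rightarrow> ennreal)
    \<Rightarrow> 'a set \<Rightarrow> ('a \<Rightarrow> 'b) \<Rightarrow> ennreal \<Rightarrow> ('a \<Rightarrow> 'b) \<Rightarrow> bool" where
  "admissible_extension X lamX Y lamY S f \<alpha> g \<longleftrightarrow>
    g ` h_set X lamX Y lamY S f \<alpha> \<subseteq> Y \<and>
    (\<forall>x \<in> S. g x = f x) \<and>
    (\<forall>x \<in> h_set X lamX Y lamY S f \<alpha>. g x \<in> (\<Inter>\<epsilon>. F_set lamX Y lamY S f \<epsilon> x))"

definition regular_extension ::
  "(ennreal \<Rightarrow> ennreal \<Rightarrow> ennreal) \<Rightarrow> 'a set \<Rightarrow> ('a filter \<Rightarrow> 'a \<Rightarrow> ennreal)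
    \<Rightarrow> 'b set \<Rightarrow> ('b filter \<Rightarrow> 'b \<Rightarrow> ennreal) \<Rightarrow> 'a set \<Rightarrow> ('a \<Rightarrow> 'b) \<Rightarrow> ennreal
    \<Rightarrow> ('a \<Rightarrow> 'b) \<Rightarrow> bool" where
  "regular_extension oplus X lamX Y lamY S f \<alpha> g \<longleftrightarrow>
    admissible_extension X lamX Y lamY S f \<alpha> g \<and>
    (\<forall>x \<in> h_set X lamX Y lamY S f \<alpha>. regularity_point oplus Y lamY (g x))"

end

theory Submission
  imports Defs
begin

text \<open>
  A filter \<open>F\<close> on \<open>h(S, f, \<alpha>)\<close> need not contain \<open>S\<close>, so the hypothesis that \<open>g x\<close> belongs to
  every \<open>F_S\<^sup>\<epsilon>(x)\<close> says nothing about \<open>g[F]\<close> directly. Strictness replaces \<open>F\<close> by a filter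
  \<open>G\<close> on \<open>S\<close> whose adherence filter \<open>G\<^bsup>(\<alpha>)\<^esup>\<close> is coarser than \<open>F\<close>, at the price of one \<open>\<alpha>\<close>
  in the limit at \<open>x\<close>. For filters on \<open>S\<close>, an admissible extension loses nothing: take \<open>\<epsilon>\<close> to be
  the limit of \<open>G\<close> at \<open>x\<close> itself
  (\<open>admissible_limit_le\<close>).

  What remains is the way back from \<open>f[G]\<close> to \<open>g[F]\<close>. The same principle, applied to the
  ultrafilters that witness membership in an adherence \<open>A\<^bsup>(\<alpha>)\<^esup>\<close> with \<open>A \<subseteq> S\<close>, shows that \<open>g\<close> maps
  the part of \<open>A\<^bsup>(\<alpha>)\<^esup>\<close> in \<open>h(S, f, \<alpha>)\<close> into \<open>(f(A))\<^bsup>(\<alpha>)\<^esup>\<close> (\<open>admissible_image_adh\<close>), so that \<open>g[F]\<close> refines \<open>f[G]\<^bsup>(\<alpha>)\<^esup>\<close>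
  (\<open>admissible_filtermap_le_adh_filter\<close>). Regularity of \<open>Y\<close> at \<open>g x\<close> then bounds the limit of \<open>g[F]\<close>
  by that of \<open>f[G]\<close>, at the price of the second \<open>\<alpha>\<close>.
\<close>

lemma filters_on_mono: "A \<subseteq> B \<Longrightarrow> F \<in> filters_on A \<Longrightarrow> F \<in> filters_on B"
  unfolding filters_on_def by (auto intro: order_trans)

lemma filters_on_filtermap:
  assumes "f ` A \<subseteq> B" and "F \<in> filters_on A"
  shows "filtermap f F \<in> filters_on B"
proof -
  have "filtermap f F \<le> principal (f ` A)"
    using assms(2) filtermap_mono[of F "principal A" f] by (simp add: filters_on_def)
  then have "filtermap f F \<le> principal B"
    by (rule order_trans) (simp add: assms(1))
  then show ?thesis
    using assms(2) by (simp add: filters_on_def filtermap_bot_iff)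
qed

lemma filters_on_eventually_mem: "F \<in> filters_on A \<Longrightarrow> \<forall>\<^sub>F x in F. x \<in> A"
  by (simp add: filters_on_def le_principal)

lemma ultrafilter_eventually_or_not:
  assumes "U \<in> ultrafilters_on X"
  shows "eventually P U \<or> eventually (\<lambda>x. \<not> P x) U"
proof (cases "inf U (principal {x. P x}) = bot")
  case True
  then have "eventually (\<lambda>_. False) (inf U (principal {x. P x}))"
    by simp
  then show ?thesis
    by (simp add: eventually_inf_principal)
next
  case False
  then have "inf U (principal {x. P x}) \<in> filters_on X"
    using assms by (auto simp: ultrafilters_on_def filters_on_def intro: le_infI1)
  then have "inf U (principal {x. P x}) = U"
    using assms by (simp add: ultrafilters_on_def)
  then have "U \<le> principal {x. P x}"
    by (simp add: inf.absorb_iff1)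
  then show ?thesis
    by (simp add: le_principal)
qed

text \<open>If a proper filter \<open>V\<close> refines \<open>f[U]\<close>, then for each set in \<open>V\<close> the ultrafilter \<open>U\<close> decides its
  preimage, and deciding it negatively would make \<open>V\<close> improper.\<close>

lemma ultrafilters_on_filtermap:
  assumes "U \<in> ultrafilters_on X" and "filtermap f U \<in> filters_on Y"
  shows "filtermap f U \<in> ultrafilters_on Y"
  unfolding ultrafilters_on_def
proof (intro CollectI conjI ballI impI)
  fix V assume V: "V \<in> filters_on Y" and le: "V \<le> filtermap f U"
  have "filtermap f U \<le> V"
  proof (rule filter_leI)
    fix P assume P: "eventually P V"
    have "\<not> eventually (\<lambda>x. \<not> P (f x)) U"
    proof
      assume "eventually (\<lambda>x. \<not> P (f x)) U"
      then have "eventually (\<lambda>y. \<not> P y) V"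
        using le by (simp add: filter_leD eventually_filtermap)
      with P have "eventually (\<lambda>_. False) V"
        by eventually_elim simp
      then show False
        using V by (simp add: filters_on_def trivial_limit_def)
    qed
    then show "eventually P (filtermap f U)"
      using ultrafilter_eventually_or_not[OF assms(1)] by (auto simp: eventually_filtermap)
  qed
  with le show "V = filtermap f U"
    by simp
qed (fact assms(2))

lemma adh_filter_le_principal: "adh_filter X lam \<epsilon> F \<le> principal X"
  unfolding le_principal eventually_adh_filter by (rule exI[of _ UNIV]) (simp add: adh_def)

lemma (in cap_space) limit_antimono:
  assumes "F \<in> filters_on X" and "G \<in> filters_on X" and "F \<le> G" and "x \<in> X"
  shows "lam F x \<le> lam G x"
  using lam_sup[of F G x] assms by (metis max.cobounded1 sup.absorb2)

text \<open>Distributivity over the two-element infima \<open>{s, t}\<close> already yields monotonicity.\<close>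

lemma (in sum_operation) oplus_mono_left:
  assumes "s \<le> t"
  shows "oplus s r \<le> oplus t r"
proof -
  have "oplus r s = oplus r (Inf {s, t})"
    using assms by (simp add: inf.absorb1)
  also have "\<dots> \<le> oplus r t"
    unfolding oplus_Inf by (rule INF_lower) simp
  finally show ?thesis
    by (simp add: oplus_commute)
qed

text \<open>Apply the membership of \<open>g x\<close> in \<open>F_S\<^sup>\<epsilon>(x)\<close> at \<open>\<epsilon> = lamX G x\<close>, the least \<open>\<epsilon>\<close>
  for which \<open>G\<close> lies in \<open>H_S\<^sup>\<epsilon>(x)\<close>.\<close>

lemma admissible_limit_le:
  assumes "admissible_extension X lamX Y lamY S f \<alpha> g"
    and "x \<in> h_set X lamX Y lamY S f \<alpha>"
    and "G \<in> filters_on S"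
  shows "lamY (filtermap f G) (g x) \<le> lamX G x"
proof -
  have "g x \<in> F_set lamX Y lamY S f (lamX G x) x"
    using assms(1,2) by (auto simp: admissible_extension_def)
  then show ?thesis
    using assms(3) by (simp add: F_set_def H_set_def)
qed

text \<open>An ultrafilter containing \<open>A \<subseteq> S\<close> lives on \<open>S\<close>, so the limit of its image at \<open>g x\<close> is
  at most its own limit at \<open>x\<close>; the image ultrafilter therefore witnesses adherence to \<open>f ` A\<close>.\<close>

lemma admissible_image_adh:
  assumes g: "admissible_extension X lamX Y lamY S f \<alpha> g"
    and f: "f ` S \<subseteq> Y"
    and x: "x \<in> h_set X lamX Y lamY S f \<alpha>"
    and "A \<subseteq> S" and "x \<in> adh X lamX \<epsilon> A"
  shows "g x \<in> adh Y lamY \<epsilon> (f ` A)"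
proof -
  obtain U where U: "U \<in> ultrafilters_on X" and A: "\<forall>\<^sub>F y in U. y \<in> A"
    and le: "lamX U x \<le> \<epsilon>"
    using assms(5) by (auto simp: adh_def)
  have "\<forall>\<^sub>F y in U. y \<in> S"
    using A by eventually_elim (use \<open>A \<subseteq> S\<close> in auto)
  then have US: "U \<in> filters_on S"
    using U by (simp add: ultrafilters_on_def filters_on_def le_principal)
  have "filtermap f U \<in> ultrafilters_on Y"
    using U filters_on_filtermap[OF f US] by (rule ultrafilters_on_filtermap)
  moreover have "\<forall>\<^sub>F y in filtermap f U. y \<in> f ` A"
    using A unfolding eventually_filtermap by eventually_elim simp
  moreover have "lamY (filtermap f U) (g x) \<le> \<epsilon>"
    using admissible_limit_le[where \<alpha> = \<alpha>, OF g x US] le by (rule order_trans)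
  moreover have "g x \<in> Y"
    using g x by (auto simp: admissible_extension_def)
  ultimately show ?thesis
    by (auto simp: adh_def)
qed

lemma admissible_filtermap_le_adh_filter:
  assumes g: "admissible_extension X lamX Y lamY S f \<alpha> g"
    and f: "f ` S \<subseteq> Y"
    and F: "F \<in> filters_on (h_set X lamX Y lamY S f \<alpha>)"
    and G: "G \<in> filters_on S"
    and le: "F \<le> adh_filter X lamX \<epsilon> G"
  shows "filtermap g F \<le> adh_filter Y lamY \<epsilon> (filtermap f G)"
proof (rule filter_leI)
  fix P assume "eventually P (adh_filter Y lamY \<epsilon> (filtermap f G))"
  then obtain B where B: "\<forall>\<^sub>F x in G. f x \<in> B" and P: "\<forall>y \<in> adh Y lamY \<epsilon> B. P y"
    by (auto simp: eventually_adh_filter eventually_filtermap)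
  define A where "A = {x \<in> S. f x \<in> B}"
  have "\<forall>\<^sub>F x in G. x \<in> A"
    using B filters_on_eventually_mem[OF G] by eventually_elim (simp add: A_def)
  then have "\<forall>\<^sub>F x in adh_filter X lamX \<epsilon> G. x \<in> adh X lamX \<epsilon> A"
    by (auto simp: eventually_adh_filter)
  then have "\<forall>\<^sub>F x in F. x \<in> adh X lamX \<epsilon> A"
    using le by (rule filter_leD[rotated])
  then have "\<forall>\<^sub>F x in F. P (g x)"
    using filters_on_eventually_mem[OF F]
  proof eventually_elim
    case (elim x)
    have "g x \<in> adh Y lamY \<epsilon> (f ` A)"
      using elim by (intro admissible_image_adh[OF g f]) (auto simp: A_def)
    moreover have "f ` A \<subseteq> B"
      by (auto simp: A_def)
    ultimately show ?case
      using P adh_mono[of "f ` A" B Y lamY \<epsilon>] by (meson subsetD)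
  qed
  then show "eventually P (filtermap g F)"
    by (simp add: eventually_filtermap)
qed

theorem theorem7:
  fixes oplus :: "ennreal \<Rightarrow> ennreal \<Rightarrow> ennreal"
    and \<alpha> :: ennreal
    and X S :: "'a set" and lamX :: "'a filter \<Rightarrow> 'a \<Rightarrow> ennreal"
    and Y :: "'b set" and lamY :: "'b filter \<Rightarrow> 'b \<Rightarrow> ennreal"
    and f g :: "'a \<Rightarrow> 'b"
  assumes "sum_operation oplus"
    and "cap_space X lamX"
    and "cap_space Y lamY"
    and "strict_subspace oplus \<alpha> X lamX S"
    and "contraction S lamX Y lamY f"
    and "regular_extension oplus X lamX Y lamY S f \<alpha> g"
  shows "measure_of_contraction oplus (h_set X lamX Y lamY S f \<alpha>) lamX Y lamY g
    \<le> oplus \<alpha> \<alpha>"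
proof -
  interpret sum_operation oplus by fact
  interpret Y: cap_space Y lamY by fact
  let ?h = "h_set X lamX Y lamY S f \<alpha>"
  have g: "admissible_extension X lamX Y lamY S f \<alpha> g"
    using assms(6) by (simp add: regular_extension_def)
  have f: "f ` S \<subseteq> Y"
    using assms(5) by (simp add: contraction_def)
  have h: "?h \<subseteq> adh X lamX \<alpha> S"
    by (auto simp: h_set_def)
  have "lamY (filtermap g F) (g x) \<le> oplus (lamX F x) (oplus \<alpha> \<alpha>)"
    if F: "F \<in> filters_on ?h" and x: "x \<in> ?h" for F x
  proof -
    obtain G where G: "G \<in> filters_on S" and FG: "F \<le> adh_filter X lamX \<alpha> G"
      and Gx: "lamX G x \<le> oplus (lamX F x) \<alpha>"
      using assms(4) filters_on_mono[OF h F] x h unfolding strict_subspace_def by blast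
    have reg: "regularity_point oplus Y lamY (g x)"
      using assms(6) x by (simp add: regular_extension_def)
    then have gx: "g x \<in> Y"
      by (simp add: regularity_point_def)
    let ?R = "adh_filter Y lamY \<alpha> (filtermap f G)"
    have le: "filtermap g F \<le> ?R"
      by (rule admissible_filtermap_le_adh_filter[OF g f F G FG])
    have gF: "filtermap g F \<in> filters_on Y"
      using g F by (intro filters_on_filtermap[where A = ?h]) (auto simp: admissible_extension_def)
    have R: "?R \<in> filters_on Y"
      using gF le by (auto simp: filters_on_def adh_filter_le_principal bot_unique)
    have "lamY (filtermap g F) (g x) \<le> lamY ?R (g x)"
      using gF R le gx by (rule Y.limit_antimono)
    also have "\<dots> \<le> oplus (lamY (filtermap f G) (g x)) \<alpha>"
      using reg filters_on_filtermap[OF f G] by (simp add: regularity_point_def)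
    also have "\<dots> \<le> oplus (lamX G x) \<alpha>"
      by (intro oplus_mono_left admissible_limit_le[OF g x G])
    also have "\<dots> \<le> oplus (oplus (lamX F x) \<alpha>) \<alpha>"
      by (intro oplus_mono_left Gx)
    finally show ?thesis
      by (simp add: oplus_assoc)
  qed
  then show ?thesis
    unfolding measure_of_contraction_def by (intro Inf_lower) blast
qed

end
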